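(* Let $k\ge4$ and let $\Psi\subseteq\Lambda_{k,r}$ be such that every $\psi\in\Psi$ is commutative. Then the following are equivalent: (a) there is a group operation $+$ on $\Omega$ and elements $\{b_\psi\}_{\psi\in\Psi}\subseteq\Omega$ such that $\psi=\psi_{(\Omega,+),b_\psi}$ for all $\psi\in\Psi$; (b) $\Psi$ is reducible.
   Context: $\Omega$ is a finite set of $r\ge2$ spins. A $k$-ary constraint function is $\psi:\Omega^k\to\{0,1\}$; write $\sigma\models\psi$ if $\psi(\sigma)=1$; juxtaposition of strings denotes concatenation. $\psi$ is uniquely extendable (UE) if for every $i\in[k]$ and every assignment of the other $k-1$ coordinates there is a unique spin in coordinate $i$ making the tuple satisfy $\psi$; $\Lambda_{k,r}$ is the set of $k$-ary UE constraint functions on $\Omega$. $\psi$ is commutative if $\sigma\models\psi\iff(\sigma_{\pi(1)},\dots,\sigma_{\pi(k)})\models\psi$ for all $\sigma\in\Omega^k$ and permutations $\pi$ of $[k]$. $\Psi$ is reducible if for all $d\in\{0,\dots,k\}$, $\sigma,\sigma'\in\Omega^d$, $\eta,\eta'\in\Omega^{k-d}$ and $\psi,\psi'\in\Psi$ with $\sigma\eta\models\psi$, $\sigma'\eta\models\psi$, $\sigma\eta'\models\psi'$, we have $\sigma'\eta'\models\psi'$. For a (not necessarily abelian) group $(\Omega,+)$ and $b\in\Omega$, $\psi_{(\Omega,+),b}$ is the constraint with $(\sigma_1,\dots,\sigma_k)\models\psi_{(\Omega,+),b}$ iff $\sigma_1+\cdots+\sigma_k=b$. *)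

theory Defs
  imports "HOL-Algebra.Group" "HOL-Combinatorics.Permutations" "HOL-Library.FuncSet"
begin

text \<open>
  The set of spins is an arbitrary carrier set \<open>\<Omega>\<close>, and strings over \<open>\<Omega>\<close> are lists, with
  coordinates indexed from 0.
\<close>

definition tuples :: "'a set \<Rightarrow> nat \<Rightarrow> 'a list set" where
  "tuples \<Omega> k = {\<sigma>. set \<sigma> \<subseteq> \<Omega> \<and> length \<sigma> = k}"

text \<open>
  Constraint functions are extensional (\<open>undefined\<close> outside \<open>\<Omega>\<^sup>k\<close>), so that HOL equality
  of two of them is equality of functions on \<open>\<Omega>\<^sup>k\<close>.
\<close>

definition constraint_functions :: "'a set \<Rightarrow> nat \<Rightarrow> ('a list \<Rightarrow> nat) set" where
  "constraint_functions \<Omega> k = tuples \<Omega> k \<rightarrow>\<^sub>E {0, 1}"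

definition satisfies :: "'a list \<Rightarrow> ('a list \<Rightarrow> nat) \<Rightarrow> bool" (infix "\<Turnstile>" 50) where
  "\<sigma> \<Turnstile> \<psi> \<longleftrightarrow> \<psi> \<sigma> = 1"

text \<open>
  In the next definition \<open>\<xi>\<close> and \<open>\<eta>\<close> assign the coordinates before and after position \<open>i\<close>.
\<close>

definition uniquely_extendable :: "'a set \<Rightarrow> nat \<Rightarrow> ('a list \<Rightarrow> nat) \<Rightarrow> bool" where
  "uniquely_extendable \<Omega> k \<psi> \<longleftrightarrow>
     (\<forall>i<k. \<forall>\<xi>\<in>tuples \<Omega> i. \<forall>\<eta>\<in>tuples \<Omega> (k - 1 - i). \<exists>!x. x \<in> \<Omega> \<and> \<xi> @ [x] @ \<eta> \<Turnstile> \<psi>)"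

definition UE_constraints :: "'a set \<Rightarrow> nat \<Rightarrow> ('a list \<Rightarrow> nat) set" where
  "UE_constraints \<Omega> k = {\<psi> \<in> constraint_functions \<Omega> k. uniquely_extendable \<Omega> k \<psi>}"

definition commutative :: "'a set \<Rightarrow> nat \<Rightarrow> ('a list \<Rightarrow> nat) \<Rightarrow> bool" where
  "commutative \<Omega> k \<psi> \<longleftrightarrow>
     (\<forall>\<sigma>\<in>tuples \<Omega> k. \<forall>\<pi>. \<pi> permutes {..<k} \<longrightarrow> (\<sigma> \<Turnstile> \<psi> \<longleftrightarrow> permute_list \<pi> \<sigma> \<Turnstile> \<psi>))"

definition reducible :: "'a set \<Rightarrow> nat \<Rightarrow> ('a list \<Rightarrow> nat) set \<Rightarrow> bool" where
  "reducible \<Omega> k \<Psi> \<longleftrightarrow>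
     (\<forall>d\<in>{0..k}. \<forall>\<sigma>\<in>tuples \<Omega> d. \<forall>\<sigma>'\<in>tuples \<Omega> d.
        \<forall>\<eta>\<in>tuples \<Omega> (k - d). \<forall>\<eta>'\<in>tuples \<Omega> (k - d). \<forall>\<psi>\<in>\<Psi>. \<forall>\<psi>'\<in>\<Psi>.
          \<sigma> @ \<eta> \<Turnstile> \<psi> \<longrightarrow> \<sigma>' @ \<eta> \<Turnstile> \<psi> \<longrightarrow> \<sigma> @ \<eta>' \<Turnstile> \<psi>' \<longrightarrow> \<sigma>' @ \<eta>' \<Turnstile> \<psi>')"

text \<open>
  The constraint \<open>\<sigma>\<^sub>1 + \<dots> + \<sigma>\<^sub>k = b\<close>; the group operation, not assumed to be abelian, is
  written multiplicatively as in the library.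
\<close>

definition group_constraint :: "('a, 'm) monoid_scheme \<Rightarrow> nat \<Rightarrow> 'a \<Rightarrow> 'a list \<Rightarrow> nat" where
  "group_constraint G k b =
     (\<lambda>\<sigma>\<in>tuples (carrier G) k. if foldr (\<otimes>\<^bsub>G\<^esub>) \<sigma> \<one>\<^bsub>G\<^esub> = b then 1 else 0)"

end

theory Submission
  imports Defs
begin

text \<open>
  Only the implication from reducibility to a group is substantial. Fix a spin \<open>e\<close>, the future
  neutral element. Reducibility with \<open>d = 2\<close> says that whether two pairs of spins are
  interchangeable depends neither on the remaining \<open>k - 2\<close> coordinates nor on \<open>\<psi>\<close>. Hence there
  is an operation such that \<open>x\<close>, \<open>y\<close> can always be replaced by \<open>x y\<close>, \<open>e\<close>. Since constraints are
  commutative, both \<open>(x y) z\<close> and \<open>x (y z)\<close>, each followed by \<open>e\<close>, \<open>e\<close>, can replace \<open>x\<close>, \<open>y\<close>,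
  \<open>z\<close>; as \<open>k \<ge> 4\<close>, the triple extends to a satisfying tuple, and unique extendability
  gives associativity. Merging all coordinates shows that \<open>\<psi>\<close> only sees the product.
\<close>

section \<open>Cyclic groups on finite sets\<close>

lemma ex_group_on_finite_set:
  assumes "finite A" "A \<noteq> {}"
  obtains G :: "'a monoid" where "group G" "carrier G = A"
proof -
  define n where "n = card A"
  have n: "n > 0" using assms by (simp add: n_def card_gt_0_iff)
  obtain h where h: "bij_betw h A {0..<n}"
    using ex_bij_betw_finite_nat[OF assms(1)] by (auto simp: n_def)
  define g where "g = inv_into A h"
  have gA: "g i \<in> A" and hg: "h (g i) = i" if "i < n" for i
    using h that unfolding g_def
    by (auto simp: bij_betw_def inv_into_into f_inv_into_f)
  have hA: "h x < n" and gh: "g (h x) = x" if "x \<in> A" for x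
    using h that unfolding g_def by (auto simp: bij_betw_def)
  define G :: "'a monoid" where
    "G = \<lparr>carrier = A, monoid.mult = \<lambda>x y. g ((h x + h y) mod n), one = g 0\<rparr>"
  have "group G"
  proof (rule groupI)
    fix x assume "x \<in> carrier G"
    then have x: "x \<in> A" by (simp add: G_def)
    \<comment> \<open>The reduction matters for \<open>h x = 0\<close>, where \<open>n - h x\<close>
      is \<open>n\<close> and so not an index.\<close>
    have "(n - h x) mod n < n" using n by simp
    moreover have "((n - h x) mod n + h x) mod n = 0"
      using hA[OF x] by (simp add: mod_add_left_eq)
    ultimately show "\<exists>y\<in>carrier G. y \<otimes>\<^bsub>G\<^esub> x = \<one>\<^bsub>G\<^esub>"
      by (intro bexI[of _ "g ((n - h x) mod n)"]) (auto simp: G_def gA hg)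
  qed (use n in \<open>auto simp: G_def gA hg gh hA mod_simps add.assoc\<close>)
  then show ?thesis by (rule that) (simp add: G_def)
qed

section \<open>Group constraints are reducible\<close>

lemma group_constraint_satisfied_iff:
  assumes "\<sigma> \<in> tuples (carrier G) k"
  shows "\<sigma> \<Turnstile> group_constraint G k b \<longleftrightarrow> foldr (\<otimes>\<^bsub>G\<^esub>) \<sigma> \<one>\<^bsub>G\<^esub> = b"
  using assms by (simp add: satisfies_def group_constraint_def)

context monoid
begin

lemma foldr_mult_closed:
  "set xs \<subseteq> carrier G \<Longrightarrow> foldr (\<otimes>) xs \<one> \<in> carrier G"
  by (induction xs) auto

lemma foldr_mult_append:
  "set xs \<subseteq> carrier G \<Longrightarrow> set ys \<subseteq> carrier G \<Longrightarrow>
    foldr (\<otimes>) (xs @ ys) \<one> = foldr (\<otimes>) xs \<one> \<otimes> foldr (\<otimes>) ys \<one>"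
  by (induction xs) (auto simp: foldr_mult_closed m_assoc simp del: foldr_append)

end

lemma (in group) reducible_group_constraints:
  assumes "\<forall>\<psi>\<in>\<Psi>. \<psi> = group_constraint G k (b \<psi>)"
  shows "reducible (carrier G) k \<Psi>"
  unfolding reducible_def
proof (intro ballI impI)
  fix d \<sigma> \<sigma>' \<eta> \<eta>' \<psi> \<psi>'
  assume d: "d \<in> {0..k}"
    and t: "\<sigma> \<in> tuples (carrier G) d" "\<sigma>' \<in> tuples (carrier G) d"
      "\<eta> \<in> tuples (carrier G) (k - d)" "\<eta>' \<in> tuples (carrier G) (k - d)"
    and \<psi>: "\<psi> \<in> \<Psi>" "\<psi>' \<in> \<Psi>"
    and sat: "\<sigma> @ \<eta> \<Turnstile> \<psi>" "\<sigma>' @ \<eta> \<Turnstile> \<psi>" "\<sigma> @ \<eta>' \<Turnstile> \<psi>'"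
  let ?p = "\<lambda>xs. foldr (\<otimes>) xs \<one>"
  have iff: "xs @ ys \<Turnstile> \<phi> \<longleftrightarrow> ?p xs \<otimes> ?p ys = b \<phi>"
    if "\<phi> \<in> \<Psi>" "xs \<in> tuples (carrier G) d" "ys \<in> tuples (carrier G) (k - d)" for \<phi> xs ys
  proof -
    have "xs @ ys \<in> tuples (carrier G) k" using that d by (auto simp: tuples_def)
    then have "xs @ ys \<Turnstile> \<phi> \<longleftrightarrow> ?p (xs @ ys) = b \<phi>"
      using group_constraint_satisfied_iff[of _ G k "b \<phi>"] assms that(1) by metis
    also have "?p (xs @ ys) = ?p xs \<otimes> ?p ys"
      using that by (intro foldr_mult_append) (auto simp: tuples_def)
    finally show ?thesis .
  qed
  have c: "?p \<sigma> \<in> carrier G" "?p \<sigma>' \<in> carrier G" "?p \<eta> \<in> carrier G"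
    using t by (auto simp: tuples_def intro!: foldr_mult_closed)
  have "?p \<sigma> \<otimes> ?p \<eta> = ?p \<sigma>' \<otimes> ?p \<eta>"
    using sat iff \<psi> t by simp
  then have "?p \<sigma> = ?p \<sigma>'"
    using c by simp
  then show "\<sigma>' @ \<eta>' \<Turnstile> \<psi>'"
    using sat iff \<psi> t by simp
qed

section \<open>Rearranging, solving and exchanging coordinates\<close>

lemma commutative_satisfies_mset_cong:
  assumes "commutative \<Omega> k \<psi>" "\<sigma> \<in> tuples \<Omega> k" "mset \<sigma> = mset \<tau>"
  shows "\<sigma> \<Turnstile> \<psi> \<longleftrightarrow> \<tau> \<Turnstile> \<psi>"
proof -
  obtain \<pi> where "\<pi> permutes {..<length \<sigma>}" "permute_list \<pi> \<sigma> = \<tau>"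
    using assms(3) by (metis mset_eq_permutation)
  then show ?thesis
    using assms(1,2) by (auto simp: commutative_def tuples_def)
qed

text \<open>\<open>\<psi>\<^sub>0\<close> is a reference constraint in which products are computed;
  reducibility carries the results over to all of \<Psi>.\<close>

locale reducible_constraints =
  fixes \<Omega> :: "'a set" and k :: nat and \<Psi> :: "('a list \<Rightarrow> nat) set"
    and \<psi>\<^sub>0 :: "'a list \<Rightarrow> nat" and e :: 'a
  assumes k: "k \<ge> 4"
    and UE: "\<Psi> \<subseteq> UE_constraints \<Omega> k"
    and comm: "\<forall>\<psi>\<in>\<Psi>. commutative \<Omega> k \<psi>"
    and red: "reducible \<Omega> k \<Psi>"
    and \<psi>\<^sub>0: "\<psi>\<^sub>0 \<in> \<Psi>"
    and e: "e \<in> \<Omega>"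
begin

text \<open>Solving for the first coordinate is enough, as commutativity can move any coordinate
  there.\<close>

lemma ex1_head:
  assumes "\<psi> \<in> \<Psi>" "set xs \<subseteq> \<Omega>" "Suc (length xs) = k"
  shows "\<exists>!x. x \<in> \<Omega> \<and> x # xs \<Turnstile> \<psi>"
proof -
  have "uniquely_extendable \<Omega> k \<psi>"
    using assms(1) UE by (auto simp: UE_constraints_def)
  then show ?thesis
    unfolding uniquely_extendable_def
    by (elim allE[of _ 0] impE ballE[of _ _ "[]"] ballE[of _ _ xs])
      (use assms k in \<open>auto simp: tuples_def\<close>)
qed

lemma satisfies_mset_cong:
  assumes "\<psi> \<in> \<Psi>" "set xs \<subseteq> \<Omega>" "length xs = k" "mset xs = mset ys"
  shows "xs \<Turnstile> \<psi> \<longleftrightarrow> ys \<Turnstile> \<psi>"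
  using assms comm by (intro commutative_satisfies_mset_cong[of \<Omega> k]) (auto simp: tuples_def)

text \<open>Reducibility gives one implication; swapping the roles of \<sigma> and \<sigma>' gives
  the other.\<close>

lemma exchange_prefix:
  assumes "\<psi> \<in> \<Psi>" "\<psi>' \<in> \<Psi>" "set (\<sigma> @ \<sigma>' @ \<eta> @ \<eta>') \<subseteq> \<Omega>" "length \<sigma>' = length \<sigma>"
    "length \<sigma> + length \<eta> = k" "length \<eta>' = length \<eta>"
    "\<sigma> @ \<eta> \<Turnstile> \<psi>" "\<sigma>' @ \<eta> \<Turnstile> \<psi>"
  shows "\<sigma> @ \<eta>' \<Turnstile> \<psi>' \<longleftrightarrow> \<sigma>' @ \<eta>' \<Turnstile> \<psi>'"
proof -
  have "length \<sigma> \<in> {0..k}" "\<sigma> \<in> tuples \<Omega> (length \<sigma>)" "\<sigma>' \<in> tuples \<Omega> (length \<sigma>)"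
    "\<eta> \<in> tuples \<Omega> (k - length \<sigma>)" "\<eta>' \<in> tuples \<Omega> (k - length \<sigma>)"
    using assms by (auto simp: tuples_def)
  with assms(1,2,7,8) red show ?thesis
    unfolding reducible_def by blast
qed

lemma ex_satisfying_tail:
  assumes "x \<in> \<Omega>" "y \<in> \<Omega>"
  obtains \<eta> where "set \<eta> \<subseteq> \<Omega>" "length \<eta> + 2 = k" "x # y # \<eta> \<Turnstile> \<psi>\<^sub>0"
proof -
  \<comment> \<open>Besides \<open>x\<close> and \<open>y\<close>, one coordinate is kept free for
    the solved spin \<open>t\<close>.\<close>
  define \<eta> where "\<eta> = replicate (k - 3) e"
  have \<eta>: "set \<eta> \<subseteq> \<Omega>" "length \<eta> + 3 = k"
    using e k by (auto simp: \<eta>_def)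
  obtain t where t: "t \<in> \<Omega>" "t # x # y # \<eta> \<Turnstile> \<psi>\<^sub>0"
    using ex1_head[OF \<psi>\<^sub>0, of "x # y # \<eta>"] assms \<eta> by auto
  have "x # y # t # \<eta> \<Turnstile> \<psi>\<^sub>0"
    by (rule satisfies_mset_cong[THEN iffD1, OF \<psi>\<^sub>0 _ _ _ t(2)]; use assms t(1) \<eta> in simp)
  with that[of "t # \<eta>"] t(1) \<eta> show ?thesis by simp
qed

section \<open>The operation and its group laws\<close>

definition op :: "'a \<Rightarrow> 'a \<Rightarrow> 'a" where
  "op x y = (SOME z. z \<in> \<Omega> \<and> (\<exists>\<eta>\<in>tuples \<Omega> (k - 2). x # y # \<eta> \<Turnstile> \<psi>\<^sub>0 \<and> z # e # \<eta> \<Turnstile> \<psi>\<^sub>0))"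

text \<open>A candidate \<open>z\<close> exists: complete \<open>x\<close>, \<open>y\<close> by some
  tail, then solve for the head in front of \<open>e\<close> and that tail. The tail behind the
  chosen value is unknown, but \<open>exchange_prefix\<close> with prefixes of length 2 passes from
  it to every tail and every constraint.\<close>

lemma op:
  assumes "x \<in> \<Omega>" "y \<in> \<Omega>"
  shows op_closed: "op x y \<in> \<Omega>"
    and satisfies_op_iff: "\<And>\<psi> \<eta>. \<lbrakk>\<psi> \<in> \<Psi>; set \<eta> \<subseteq> \<Omega>; length \<eta> + 2 = k\<rbrakk> \<Longrightarrow>
      x # y # \<eta> \<Turnstile> \<psi> \<longleftrightarrow> op x y # e # \<eta> \<Turnstile> \<psi>"
proof -
  obtain \<eta>\<^sub>0 where "set \<eta>\<^sub>0 \<subseteq> \<Omega>" "length \<eta>\<^sub>0 + 2 = k" and "x # y # \<eta>\<^sub>0 \<Turnstile> \<psi>\<^sub>0"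
    using ex_satisfying_tail assms .
  moreover from this obtain z where "z \<in> \<Omega>" "z # e # \<eta>\<^sub>0 \<Turnstile> \<psi>\<^sub>0"
    using ex1_head[OF \<psi>\<^sub>0, of "e # \<eta>\<^sub>0"] e by auto
  moreover have "\<eta>\<^sub>0 \<in> tuples \<Omega> (k - 2)"
    using calculation by (auto simp: tuples_def)
  ultimately have
    "\<exists>z. z \<in> \<Omega> \<and> (\<exists>\<eta>\<in>tuples \<Omega> (k - 2). x # y # \<eta> \<Turnstile> \<psi>\<^sub>0 \<and> z # e # \<eta> \<Turnstile> \<psi>\<^sub>0)"
    by blast
  from someI_ex[OF this] obtain \<eta> where cl: "op x y \<in> \<Omega>"
    and \<eta>: "\<eta> \<in> tuples \<Omega> (k - 2)" "x # y # \<eta> \<Turnstile> \<psi>\<^sub>0" "op x y # e # \<eta> \<Turnstile> \<psi>\<^sub>0"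
    unfolding op_def[symmetric] by blast
  show "op x y \<in> \<Omega>" by (fact cl)
  show "x # y # \<eta>' \<Turnstile> \<psi> \<longleftrightarrow> op x y # e # \<eta>' \<Turnstile> \<psi>"
    if "\<psi> \<in> \<Psi>" "set \<eta>' \<subseteq> \<Omega>" "length \<eta>' + 2 = k" for \<psi> \<eta>'
    using exchange_prefix[OF \<psi>\<^sub>0 that(1), of "[x, y]" "[op x y, e]" \<eta> \<eta>']
      \<eta> cl assms e k that(2,3) by (auto simp: tuples_def)
qed

lemma head_unique:
  assumes "\<psi> \<in> \<Psi>" "set xs \<subseteq> \<Omega>" "Suc (length xs) = k"
    "x \<in> \<Omega>" "x # xs \<Turnstile> \<psi>" "y \<in> \<Omega>" "y # xs \<Turnstile> \<psi>"
  shows "x = y"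
  using ex1_head[OF assms(1-3)] assms(4-) by blast

text \<open>Both products solve the same equation for the head, since one tail completes
  \<open>x\<close>, \<open>y\<close> and \<open>y\<close>, \<open>x\<close> alike.\<close>

lemma op_commute:
  assumes "x \<in> \<Omega>" "y \<in> \<Omega>"
  shows "op x y = op y x"
proof -
  obtain \<eta> where \<eta>: "set \<eta> \<subseteq> \<Omega>" "length \<eta> + 2 = k" "x # y # \<eta> \<Turnstile> \<psi>\<^sub>0"
    using ex_satisfying_tail assms .
  have "y # x # \<eta> \<Turnstile> \<psi>\<^sub>0"
    by (rule satisfies_mset_cong[THEN iffD1, OF \<psi>\<^sub>0 _ _ _ \<eta>(3)]) (use assms \<eta> in auto)
  then have "op x y # e # \<eta> \<Turnstile> \<psi>\<^sub>0" "op y x # e # \<eta> \<Turnstile> \<psi>\<^sub>0"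
    using satisfies_op_iff \<psi>\<^sub>0 assms \<eta> by auto
  then show ?thesis
    using head_unique[OF \<psi>\<^sub>0, of "e # \<eta>"] op_closed assms e \<eta> by simp
qed

lemma satisfies_op_op_iff:
  assumes "x \<in> \<Omega>" "y \<in> \<Omega>" "z \<in> \<Omega>" "\<psi> \<in> \<Psi>" "set \<eta> \<subseteq> \<Omega>" "length \<eta> + 3 = k"
  shows "x # y # z # \<eta> \<Turnstile> \<psi> \<longleftrightarrow> op (op x y) z # e # e # \<eta> \<Turnstile> \<psi>"
proof -
  have "x # y # z # \<eta> \<Turnstile> \<psi> \<longleftrightarrow> op x y # e # z # \<eta> \<Turnstile> \<psi>"
    using assms by (intro satisfies_op_iff) auto
  \<comment> \<open>The \<open>e\<close> left by the first merge is moved aside, making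
    \<open>z\<close> the second entry.\<close>
  also have "\<dots> \<longleftrightarrow> op x y # z # e # \<eta> \<Turnstile> \<psi>"
    using assms e by (intro satisfies_mset_cong) (auto simp: op_closed)
  also have "\<dots> \<longleftrightarrow> op (op x y) z # e # e # \<eta> \<Turnstile> \<psi>"
    using assms e by (intro satisfies_op_iff) (auto simp: op_closed)
  finally show ?thesis .
qed

text \<open>Since \<open>satisfies_op_op_iff\<close> brackets to the left only, it is applied to
  \<open>x\<close>, \<open>y\<close>, \<open>z\<close> and to the rotation \<open>y\<close>,
  \<open>z\<close>, \<open>x\<close>; \<open>op_commute\<close> then gives the usual form.\<close>

lemma op_assoc:
  assumes "x \<in> \<Omega>" "y \<in> \<Omega>" "z \<in> \<Omega>"
  shows "op (op x y) z = op x (op y z)"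
proof -
  \<comment> \<open>Three coordinates hold \<open>x\<close>, \<open>y\<close>, \<open>z\<close> and
    a fourth is solved for; this is where \<open>k \<ge> 4\<close> enters.\<close>
  define \<eta> where "\<eta> = replicate (k - 4) e"
  have \<eta>: "set \<eta> \<subseteq> \<Omega>" "length \<eta> + 4 = k"
    using e k by (auto simp: \<eta>_def)
  obtain t where t: "t \<in> \<Omega>" "t # x # y # z # \<eta> \<Turnstile> \<psi>\<^sub>0"
    using ex1_head[OF \<psi>\<^sub>0, of "x # y # z # \<eta>"] assms \<eta> by auto
  have "x # y # z # t # \<eta> \<Turnstile> \<psi>\<^sub>0" "y # z # x # t # \<eta> \<Turnstile> \<psi>\<^sub>0"
    by (rule satisfies_mset_cong[THEN iffD1, OF \<psi>\<^sub>0 _ _ _ t(2)]; use assms t(1) \<eta> in simp)+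
  then have "op (op x y) z # e # e # t # \<eta> \<Turnstile> \<psi>\<^sub>0" "op (op y z) x # e # e # t # \<eta> \<Turnstile> \<psi>\<^sub>0"
    using satisfies_op_op_iff \<psi>\<^sub>0 assms t(1) \<eta> by auto
  then have "op (op x y) z = op (op y z) x"
    using head_unique[OF \<psi>\<^sub>0, of "e # e # t # \<eta>"] op_closed assms e t(1) \<eta> by simp
  then show ?thesis
    using op_commute op_closed assms by simp
qed

text \<open>A single common tail suffices to evaluate a product.\<close>

lemma op_eqI:
  assumes "x \<in> \<Omega>" "y \<in> \<Omega>" "z \<in> \<Omega>" "set \<eta> \<subseteq> \<Omega>" "length \<eta> + 2 = k"
    "x # y # \<eta> \<Turnstile> \<psi>\<^sub>0" "z # e # \<eta> \<Turnstile> \<psi>\<^sub>0"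
  shows "op x y = z"
  using head_unique[OF \<psi>\<^sub>0, of "e # \<eta>"] satisfies_op_iff[OF assms(1,2) \<psi>\<^sub>0 assms(4,5)]
    op_closed assms e by simp

definition constraint_group :: "'a monoid" where
  "constraint_group = \<lparr>carrier = \<Omega>, monoid.mult = op, one = e\<rparr>"

lemma constraint_group_sel [simp]:
  "carrier constraint_group = \<Omega>" "monoid.mult constraint_group = op" "one constraint_group = e"
  by (simp_all add: constraint_group_def)

text \<open>For \<open>y = e\<close> and \<open>z = x\<close> the two satisfaction premises of
  \<open>op_eqI\<close> coincide.\<close>

lemma op_e_right: "x \<in> \<Omega> \<Longrightarrow> op x e = x"
  using op_eqI ex_satisfying_tail e by metis

lemma group_constraint_group: "group constraint_group"
proof (rule groupI)
  fix x assume "x \<in> carrier constraint_group"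
  then have x: "x \<in> \<Omega>" by simp
  show "\<one>\<^bsub>constraint_group\<^esub> \<otimes>\<^bsub>constraint_group\<^esub> x = x"
    using x e by (simp add: op_commute[of e x] op_e_right)
  \<comment> \<open>A left inverse is a spin \<open>y\<close> for which \<open>y\<close>,
    \<open>x\<close> can replace \<open>e\<close>, \<open>e\<close> in front of a satisfying
    tail.\<close>
  obtain \<eta> where \<eta>: "set \<eta> \<subseteq> \<Omega>" "length \<eta> + 2 = k" "e # e # \<eta> \<Turnstile> \<psi>\<^sub>0"
    using ex_satisfying_tail e by blast
  obtain y where y: "y \<in> \<Omega>" "y # x # \<eta> \<Turnstile> \<psi>\<^sub>0"
    using ex1_head[OF \<psi>\<^sub>0, of "x # \<eta>"] \<eta> x by auto
  then have "op y x = e"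
    using op_eqI \<eta> x e by blast
  with y show "\<exists>y\<in>carrier constraint_group.
      y \<otimes>\<^bsub>constraint_group\<^esub> x = \<one>\<^bsub>constraint_group\<^esub>"
    by auto
qed (auto simp: op_closed op_assoc e)

section \<open>Constraints as conditions on the product\<close>

lemma foldr_op_closed: "set xs \<subseteq> \<Omega> \<Longrightarrow> foldr op xs e \<in> \<Omega>"
  by (induction xs) (auto simp: e op_closed)

text \<open>Merging keeps the length: the product fills one slot and \<open>e\<close> all others, so
  the block must be nonempty. The tail \<eta> varies in the induction because it temporarily takes
  up the head.\<close>

lemma satisfies_foldr_op_iff:
  assumes "\<psi> \<in> \<Psi>"
  shows "\<lbrakk>set (x # xs) \<subseteq> \<Omega>; set \<eta> \<subseteq> \<Omega>; length (x # xs) + length \<eta> = k\<rbrakk> \<Longrightarrow>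
    x # xs @ \<eta> \<Turnstile> \<psi> \<longleftrightarrow> foldr op (x # xs) e # replicate (length xs) e @ \<eta> \<Turnstile> \<psi>"
proof (induction xs arbitrary: x \<eta>)
  case Nil
  then show ?case by (simp add: op_e_right)
next
  case (Cons y ys)
  let ?p = "foldr op (y # ys) e" and ?r = "replicate (length ys) e"
  have p: "?p \<in> \<Omega>" using Cons.prems by (intro foldr_op_closed) auto
  have r: "set ?r \<subseteq> \<Omega>" using e by auto
  \<comment> \<open>\<open>x\<close> is parked in the tail while the induction hypothesis merges
    \<open>y # ys\<close>, then brought back for one last merge.\<close>
  have "x # (y # ys) @ \<eta> \<Turnstile> \<psi> \<longleftrightarrow> y # ys @ (x # \<eta>) \<Turnstile> \<psi>"
    using Cons.prems assms by (intro satisfies_mset_cong) auto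
  also have "\<dots> \<longleftrightarrow> ?p # ?r @ (x # \<eta>) \<Turnstile> \<psi>"
    using Cons.prems by (intro Cons.IH) auto
  also have "\<dots> \<longleftrightarrow> x # ?p # ?r @ \<eta> \<Turnstile> \<psi>"
    using Cons.prems assms p r by (intro satisfies_mset_cong) (auto simp del: foldr.simps)
  also have "\<dots> \<longleftrightarrow> op x ?p # e # ?r @ \<eta> \<Turnstile> \<psi>"
    using Cons.prems assms p r by (intro satisfies_op_iff) auto
  finally show ?case by simp
qed

lemma constraint_eq_group_constraint:
  assumes "\<psi> \<in> \<Psi>"
  shows "\<exists>b\<in>\<Omega>. \<psi> = group_constraint constraint_group k b"
proof -
  let ?r = "replicate (k - 1) e"
  have r: "set ?r \<subseteq> \<Omega>" "Suc (length ?r) = k" using e k by auto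
  \<comment> \<open>The right-hand side is read off from the tuple whose other entries are all
    neutral.\<close>
  obtain b where b: "b \<in> \<Omega>" "b # ?r \<Turnstile> \<psi>"
    using ex1_head[OF assms r] by blast
  have sat: "\<sigma> \<Turnstile> \<psi> \<longleftrightarrow> foldr op \<sigma> e = b" if \<sigma>k: "\<sigma> \<in> tuples \<Omega> k" for \<sigma>
  proof -
    obtain x xs where \<sigma>: "\<sigma> = x # xs" "length xs = k - 1"
      using \<sigma>k k by (cases \<sigma>) (auto simp: tuples_def)
    have "\<sigma> \<Turnstile> \<psi> \<longleftrightarrow> foldr op \<sigma> e # ?r \<Turnstile> \<psi>"
      using satisfies_foldr_op_iff[OF assms, of x xs "[]"] \<sigma>k \<sigma> k by (auto simp: tuples_def)
    also have "\<dots> \<longleftrightarrow> foldr op \<sigma> e = b"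
      using head_unique[OF assms r] foldr_op_closed[of \<sigma>] \<sigma>k b by (auto simp: tuples_def)
    finally show ?thesis .
  qed
  have \<psi>: "\<psi> \<in> tuples \<Omega> k \<rightarrow>\<^sub>E {0, 1}"
    using assms UE unfolding UE_constraints_def constraint_functions_def by blast
  have "\<psi> = group_constraint constraint_group k b"
  proof (rule ext)
    fix \<sigma>
    show "\<psi> \<sigma> = group_constraint constraint_group k b \<sigma>"
    proof (cases "\<sigma> \<in> tuples \<Omega> k")
      case True
      have "\<psi> \<sigma> \<in> {0, 1}" using \<psi> True by (rule PiE_mem)
      then have "\<psi> \<sigma> = (if \<sigma> \<Turnstile> \<psi> then 1 else 0)"
        by (auto simp: satisfies_def)
      also have "\<dots> = group_constraint constraint_group k b \<sigma>"
        unfolding sat[OF True] using True by (simp add: group_constraint_def)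
      finally show ?thesis .
    next
      case False
      \<comment> \<open>Both functions are extensional, hence \<open>undefined\<close> here.\<close>
      with PiE_arb[OF \<psi>] show ?thesis by (simp add: group_constraint_def)
    qed
  qed
  with b(1) show ?thesis by blast
qed

end

theorem theorem1p17:
  fixes \<Omega> :: "'a set" and r k :: nat and \<Psi> :: "('a list \<Rightarrow> nat) set"
  assumes "finite \<Omega>" and "card \<Omega> = r" and "r \<ge> 2"
    and "k \<ge> 4"
    and "\<Psi> \<subseteq> UE_constraints \<Omega> k"
    and "\<forall>\<psi>\<in>\<Psi>. commutative \<Omega> k \<psi>"
  shows "(\<exists>(G :: 'a monoid) (b :: ('a list \<Rightarrow> nat) \<Rightarrow> 'a).
            group G \<and> carrier G = \<Omega> \<and>
            (\<forall>\<psi>\<in>\<Psi>. b \<psi> \<in> \<Omega> \<and> \<psi> = group_constraint G k (b \<psi>)))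
         \<longleftrightarrow> reducible \<Omega> k \<Psi>"
    (is "?group \<longleftrightarrow> _")
proof
  assume ?group
  then show "reducible \<Omega> k \<Psi>"
    using group.reducible_group_constraints by blast
next
  assume red: "reducible \<Omega> k \<Psi>"
  have "\<Omega> \<noteq> {}" using assms(2,3) by auto
  show ?group
  proof (cases "\<Psi> = {}")
    \<comment> \<open>There is no reference constraint to build an operation from, but any group on
      \<Omega> will do.\<close>
    case True
    then show ?thesis
      using ex_group_on_finite_set[OF assms(1) \<open>\<Omega> \<noteq> {}\<close>] by (metis empty_iff)
  next
    case False
    then obtain \<psi>\<^sub>0 e where "\<psi>\<^sub>0 \<in> \<Psi>" "e \<in> \<Omega>" using \<open>\<Omega> \<noteq> {}\<close> by blast
    then interpret reducible_constraints \<Omega> k \<Psi> \<psi>\<^sub>0 e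
      using assms red by unfold_locales
    obtain b where "\<forall>\<psi>\<in>\<Psi>. b \<psi> \<in> \<Omega> \<and> \<psi> = group_constraint constraint_group k (b \<psi>)"
      using constraint_eq_group_constraint by metis
    then show ?thesis
      using group_constraint_group constraint_group_sel(1) by blast
  qed
qed

end
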